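(* Let $M$ be a canal surface in $\mathbb{R}^3$ with center curve $\alpha(s)$ and radius $r(s)$. Suppose the center curve $\alpha$ is a straight line. Then $M$ is a regular surface in $\mathbb{R}^3$ if and only if the radius function $r$ is neither of the form $r(s)=\pm s+c$ (with $c$ a constant) nor of the form $r(s)=\sqrt{s^{2}-2c_{1}s+2c_{2}}$ (with $c_1,c_2$ constants).
   Context: A canal surface is the envelope of a 1-parameter family of spheres in $\mathbb{R}^3$. The curve $\alpha : I\to\mathbb{R}^3$ of centers ($I$ an interval) is the center curve, assumed parametrized by arc length $s$, and $r:I\to(0,\infty)$, the radius, is the smooth function such that $r(s)$ is the radius of the sphere centered at $\alpha(s)$. Let $T,N,B$ be the Frenet frame of $\alpha$ (when $\alpha$ is a straight line, $T,N,B$ is a constant orthonormal frame with $T=\alpha'$; e.g. $\alpha(s)=(s,0,0)$, $T=e_1,N=e_2,B=e_3$). The canal surface is parametrized by $$C(s,t)=\alpha(s)-R(s)T-Q(s)\cos(t)\,N+Q(s)\sin(t)\,B,$$ where $R(s)=r(s)r'(s)$ and $Q(s)=\pm r(s)\sqrt{1-r'(s)^2}$ (so $|r'|\le 1$). The first fundamental form has coefficients $E=\langle C_s,C_s\rangle$, $F=\langle C_s,C_t\rangle$, $G=\langle C_t,C_t\rangle$; the surface is called degenerate if its first fundamental form is degenerate ($EG-F^2=0$), and regular means non-degenerate. *)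

theory Defs
  imports "HOL-Analysis.Analysis"
begin

text \<open>
  All derivatives in the arc length parameter are taken within the parameter interval \<open>I\<close>, so
  they are one-sided at an end point belonging to \<open>I\<close>. Values of functions outside \<open>I\<close> are
  irrelevant.
\<close>

definition D_on :: "real set \<Rightarrow> (real \<Rightarrow> 'a) \<Rightarrow> real \<Rightarrow> 'a :: real_normed_vector" where
  "D_on I f s = vector_derivative f (at s within I)"

definition smooth_on_interval :: "real set \<Rightarrow> (real \<Rightarrow> 'a :: real_normed_vector) \<Rightarrow> bool" where
  "smooth_on_interval I f \<longleftrightarrow> (\<forall>n. ((D_on I ^^ n) f) differentiable_on I)"

definition nondegenerate_interval :: "real set \<Rightarrow> bool" where
  "nondegenerate_interval I \<longleftrightarrow> is_interval I \<and> interior I \<noteq> {}"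

definition arclength_curve :: "real set \<Rightarrow> (real \<Rightarrow> real^3) \<Rightarrow> bool" where
  "arclength_curve I \<alpha> \<longleftrightarrow> smooth_on_interval I \<alpha> \<and> (\<forall>s\<in>I. norm (D_on I \<alpha> s) = 1)"

definition straight_line :: "real set \<Rightarrow> (real \<Rightarrow> real^3) \<Rightarrow> bool" where
  "straight_line I \<alpha> \<longleftrightarrow> collinear (\<alpha> ` I)"

definition orthonormal3 :: "real^3 \<Rightarrow> real^3 \<Rightarrow> real^3 \<Rightarrow> bool" where
  "orthonormal3 u v w \<longleftrightarrow>
     norm u = 1 \<and> norm v = 1 \<and> norm w = 1 \<and> u \<bullet> v = 0 \<and> u \<bullet> w = 0 \<and> v \<bullet> w = 0"

text \<open>
  The Frenet frame of a unit speed curve. A straight line has no canonical normal; any constant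
  orthonormal frame (of either orientation) with tangent \<open>\<alpha>'\<close> is admitted there.
  Otherwise the curvature has to be nonzero, so that the principal normal exists.
\<close>

definition frenet_frame ::
  "real set \<Rightarrow> (real \<Rightarrow> real^3) \<Rightarrow> (real \<Rightarrow> real^3) \<Rightarrow> (real \<Rightarrow> real^3) \<Rightarrow> (real \<Rightarrow> real^3) \<Rightarrow> bool" where
  "frenet_frame I \<alpha> T N B \<longleftrightarrow>
     (\<forall>s\<in>I. T s = D_on I \<alpha> s) \<and>
     (if straight_line I \<alpha>
      then T constant_on I \<and> N constant_on I \<and> B constant_on I \<and>
           (\<forall>s\<in>I. orthonormal3 (T s) (N s) (B s))
      else (\<forall>s\<in>I. D_on I T s \<noteq> 0 \<and>
                  N s = D_on I T s /\<^sub>R norm (D_on I T s) \<and>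
                  B s = cross3 (T s) (N s)))"

definition canal_R :: "real set \<Rightarrow> (real \<Rightarrow> real) \<Rightarrow> real \<Rightarrow> real" where
  "canal_R I r s = r s * D_on I r s"

text \<open>The parameter \<open>\<sigma>\<close> is the choice of sign in \<open>Q\<close>, made once for the whole surface.\<close>

definition canal_Q :: "real set \<Rightarrow> real \<Rightarrow> (real \<Rightarrow> real) \<Rightarrow> real \<Rightarrow> real" where
  "canal_Q I \<sigma> r s = \<sigma> * (r s * sqrt (1 - (D_on I r s)\<^sup>2))"

definition canal_param ::
  "real set \<Rightarrow> (real \<Rightarrow> real^3) \<Rightarrow> (real \<Rightarrow> real^3) \<Rightarrow> (real \<Rightarrow> real^3) \<Rightarrow> (real \<Rightarrow> real^3) \<Rightarrow>
   real \<Rightarrow> (real \<Rightarrow> real) \<Rightarrow> real \<Rightarrow> real \<Rightarrow> real^3" where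
  "canal_param I \<alpha> T N B \<sigma> r s t =
     \<alpha> s - canal_R I r s *\<^sub>R T s - (canal_Q I \<sigma> r s * cos t) *\<^sub>R N s
         + (canal_Q I \<sigma> r s * sin t) *\<^sub>R B s"

definition canal_data ::
  "real set \<Rightarrow> (real \<Rightarrow> real^3) \<Rightarrow> (real \<Rightarrow> real^3) \<Rightarrow> (real \<Rightarrow> real^3) \<Rightarrow> (real \<Rightarrow> real^3) \<Rightarrow>
   real \<Rightarrow> (real \<Rightarrow> real) \<Rightarrow> bool" where
  "canal_data I \<alpha> T N B \<sigma> r \<longleftrightarrow>
     nondegenerate_interval I \<and> arclength_curve I \<alpha> \<and> frenet_frame I \<alpha> T N B \<and>
     \<sigma> \<in> {1, -1} \<and>
     smooth_on_interval I r \<and> (\<forall>s\<in>I. 0 < r s) \<and> (\<forall>s\<in>I. \<bar>D_on I r s\<bar> \<le> 1)"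

definition partial_s :: "real set \<Rightarrow> (real \<Rightarrow> real \<Rightarrow> real^3) \<Rightarrow> real \<Rightarrow> real \<Rightarrow> real^3" where
  "partial_s I X s t = D_on I (\<lambda>u. X u t) s"

definition partial_t :: "(real \<Rightarrow> real \<Rightarrow> real^3) \<Rightarrow> real \<Rightarrow> real \<Rightarrow> real^3" where
  "partial_t X s t = vector_derivative (X s) (at t)"

definition coeff_E :: "real set \<Rightarrow> (real \<Rightarrow> real \<Rightarrow> real^3) \<Rightarrow> real \<Rightarrow> real \<Rightarrow> real" where
  "coeff_E I X s t = partial_s I X s t \<bullet> partial_s I X s t"

definition coeff_F :: "real set \<Rightarrow> (real \<Rightarrow> real \<Rightarrow> real^3) \<Rightarrow> real \<Rightarrow> real \<Rightarrow> real" where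
  "coeff_F I X s t = partial_s I X s t \<bullet> partial_t X s t"

definition coeff_G :: "(real \<Rightarrow> real \<Rightarrow> real^3) \<Rightarrow> real \<Rightarrow> real \<Rightarrow> real" where
  "coeff_G X s t = partial_t X s t \<bullet> partial_t X s t"

text \<open>
  A surface is degenerate if \<open>EG - F\<^sup>2 = 0\<close> as an identity on the parameter domain, and regular
  if it is not degenerate; an isolated zero of \<open>EG - F\<^sup>2\<close> does not make it degenerate.
  Where \<open>\<bar>r'\<bar> = 1\<close> the function \<open>Q\<close>, and hence the parametrization, may fail to be
  differentiable in \<open>s\<close>. There \<open>Q = 0\<close>, so the partial derivative in \<open>t\<close> is zero and
  \<open>EG - F\<^sup>2 = 0\<close> whatever value \<open>vector_derivative\<close> takes.
\<close>

definition degenerate_surface :: "real set \<Rightarrow> (real \<Rightarrow> real \<Rightarrow> real^3) \<Rightarrow> bool" where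
  "degenerate_surface I X \<longleftrightarrow>
     (\<forall>s\<in>I. \<forall>t. coeff_E I X s t * coeff_G X s t - (coeff_F I X s t)\<^sup>2 = 0)"

definition regular_surface :: "real set \<Rightarrow> (real \<Rightarrow> real \<Rightarrow> real^3) \<Rightarrow> bool" where
  "regular_surface I X \<longleftrightarrow> \<not> degenerate_surface I X"

end

theory Submission
  imports Defs
begin

text \<open>
  Along a straight line the frame is constant, so \<open>F = 0\<close> and
  \<open>EG - F\<^sup>2 = Q\<^sup>2 ((1 - R')\<^sup>2 + Q'\<^sup>2)\<close> wherever \<open>Q\<close> is differentiable. Hence degeneracy forces
  \<open>Q = 0\<close> or \<open>R' = 1\<close> at each point. Since \<open>q = Q\<^sup>2 = r\<^sup>2 - R\<^sup>2\<close> has derivative \<open>2 R (1 - R')\<close>,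
  \<open>q\<^sup>2\<close> has derivative zero, and so \<open>q\<close> is constant. If \<open>q = 0\<close>, then \<open>r'\<^sup>2 = 1\<close>, and \<open>r'\<close> has
  constant sign by continuity; otherwise \<open>(r\<^sup>2)'' = 2 R' = 2\<close> on the whole interval.
\<close>

section \<open>Derivatives on an interval\<close>

text \<open>A connected set with more than one point has no isolated points. This makes derivatives
  within \<open>I\<close> unique, end points included.\<close>

lemma nondegenerate_interval_not_bot:
  assumes "nondegenerate_interval I" "s \<in> I"
  shows "at s within I \<noteq> bot"
proof -
  have "connected I" "interior I \<noteq> {}"
    using assms(1) by (auto simp: nondegenerate_interval_def is_interval_connected_1)
  moreover have "I \<noteq> {a}" for a
    using \<open>interior I \<noteq> {}\<close> by auto
  ultimately show ?thesis
    using connected_imp_perfect assms(2) by (metis trivial_limit_within)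
qed

lemma D_on_eqI:
  assumes "nondegenerate_interval I" "s \<in> I" "(f has_vector_derivative d) (at s within I)"
  shows "D_on I f s = d"
  unfolding D_on_def
  using vector_derivative_within assms nondegenerate_interval_not_bot by blast

lemma smooth_on_interval_D_on:
  assumes "smooth_on_interval I f" "s \<in> I"
  shows "(f has_vector_derivative D_on I f s) (at s within I)"
    and "(D_on I f has_vector_derivative D_on I (D_on I f) s) (at s within I)"
proof -
  have "f differentiable (at s within I)"
    using assms unfolding smooth_on_interval_def differentiable_on_def
    by (metis funpow_0)
  then show "(f has_vector_derivative D_on I f s) (at s within I)"
    by (simp add: D_on_def vector_derivative_works)
  have "((D_on I ^^ Suc 0) f) differentiable_on I"
    using assms(1) unfolding smooth_on_interval_def by blast
  then have "D_on I f differentiable (at s within I)"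
    using assms(2) by (simp add: differentiable_on_def)
  then show "(D_on I f has_vector_derivative D_on I (D_on I f) s) (at s within I)"
    by (simp add: D_on_def[of I "D_on I f"] vector_derivative_works)
qed

lemma zero_derivative_constant:
  fixes f :: "real \<Rightarrow> real"
  assumes "nondegenerate_interval I"
    and "\<And>s. s \<in> I \<Longrightarrow> (f has_real_derivative 0) (at s within I)"
  obtains c where "\<And>s. s \<in> I \<Longrightarrow> f s = c"
proof -
  have "convex I"
    using assms(1) by (simp add: nondegenerate_interval_def is_interval_convex_1)
  then obtain c where "\<forall>s\<in>I. f s = c"
    using has_field_derivative_zero_constant[OF _ assms(2)] by fast
  with that show ?thesis
    by simp
qed

text \<open>A continuous function with finite range on a connected set is constant, so the sign
  cannot change along \<open>I\<close>.\<close>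

lemma continuous_square_one_cases:
  fixes f :: "real \<Rightarrow> real"
  assumes "connected I" "continuous_on I f" "\<And>s. s \<in> I \<Longrightarrow> (f s)\<^sup>2 = 1"
  shows "(\<forall>s\<in>I. f s = 1) \<or> (\<forall>s\<in>I. f s = -1)"
proof -
  have "f ` I \<subseteq> {1, -1}"
    using assms(3) by (auto simp: power2_eq_1_iff)
  then have "finite (f ` I)"
    using finite_subset by blast
  then obtain c where "\<forall>s\<in>I. f s = c"
    using continuous_finite_range_constant[OF assms(1,2)] by (auto simp: constant_on_def)
  \<comment> \<open>The value \<open>c\<close> is tied to \<open>f\<close> only through a point of
    \<open>I\<close>; for empty \<open>I\<close> both alternatives hold vacuously.\<close>
  moreover have "c\<^sup>2 = 1" if "s \<in> I" for s
    using assms(3)[OF that] \<open>\<forall>s\<in>I. f s = c\<close> that by simp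
  ultimately show ?thesis
    unfolding power2_eq_1_iff by auto
qed

section \<open>Canal surfaces with a constant frame\<close>

text \<open>With \<open>s\<close> fixed, \<open>R\<close> and \<open>Q\<close> are mere
  coefficients, so the formula also holds where \<open>Q\<close> is not differentiable in
  \<open>s\<close>.\<close>

lemma canal_partial_t:
  "partial_t (canal_param I \<alpha> T N B \<sigma> r) s t =
     canal_Q I \<sigma> r s *\<^sub>R (sin t *\<^sub>R N s + cos t *\<^sub>R B s)"
proof -
  have "(canal_param I \<alpha> T N B \<sigma> r s has_vector_derivative
      canal_Q I \<sigma> r s *\<^sub>R (sin t *\<^sub>R N s + cos t *\<^sub>R B s)) (at t)"
    unfolding canal_param_def
    by (auto intro!: derivative_eq_intros simp: algebra_simps scaleR_add_right)
  then show ?thesis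
    by (simp add: partial_t_def vector_derivative_at)
qed

text \<open>A constant frame contributes no derivatives, so only \<alpha>, \<open>R\<close> and
  \<open>Q\<close> are differentiated. The frame is known on \<open>I\<close> alone, hence the
  passage through a function that agrees with the parametrization there.\<close>

lemma canal_partial_s:
  assumes "nondegenerate_interval I" "s \<in> I"
    and frame: "\<And>u. u \<in> I \<Longrightarrow> T u = T0" "\<And>u. u \<in> I \<Longrightarrow> N u = N0" "\<And>u. u \<in> I \<Longrightarrow> B u = B0"
    and \<alpha>: "(\<alpha> has_vector_derivative T0) (at s within I)"
    and R: "(canal_R I r has_real_derivative R') (at s within I)"
    and Q: "(canal_Q I \<sigma> r has_real_derivative Q') (at s within I)"
  shows "partial_s I (canal_param I \<alpha> T N B \<sigma> r) s t =
    (1 - R') *\<^sub>R T0 - (Q' * cos t) *\<^sub>R N0 + (Q' * sin t) *\<^sub>R B0"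
proof -
  have "((\<lambda>u. \<alpha> u - canal_R I r u *\<^sub>R T0 - (canal_Q I \<sigma> r u * cos t) *\<^sub>R N0
      + (canal_Q I \<sigma> r u * sin t) *\<^sub>R B0) has_vector_derivative
      (1 - R') *\<^sub>R T0 - (Q' * cos t) *\<^sub>R N0 + (Q' * sin t) *\<^sub>R B0) (at s within I)"
    by (auto intro!: derivative_eq_intros \<alpha> R Q simp: algebra_simps)
  then have "((\<lambda>u. canal_param I \<alpha> T N B \<sigma> r u t) has_vector_derivative
      (1 - R') *\<^sub>R T0 - (Q' * cos t) *\<^sub>R N0 + (Q' * sin t) *\<^sub>R B0) (at s within I)"
    by (rule has_vector_derivative_transform[rotated 2])
      (use assms(2) frame in \<open>auto simp: canal_param_def\<close>)
  then show ?thesis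
    unfolding partial_s_def using assms(1,2) by (rule D_on_eqI[rotated 2])
qed

text \<open>The vectors \<open>u\<close>, \<open>- cos t *\<^sub>R v + sin t *\<^sub>R w\<close> and
  \<open>sin t *\<^sub>R v + cos t *\<^sub>R w\<close> are again orthonormal; \<open>X\<close> lies
  in the span of the first two and \<open>Y\<close> along the third, so the mixed product
  vanishes.\<close>

lemma orthonormal3_gram_det:
  assumes "orthonormal3 u v w"
    and X: "X = a *\<^sub>R u - (b * cos t) *\<^sub>R v + (b * sin t) *\<^sub>R w"
    and Y: "Y = q *\<^sub>R (sin t *\<^sub>R v + cos t *\<^sub>R w)"
  shows "(X \<bullet> X) * (Y \<bullet> Y) - (X \<bullet> Y)\<^sup>2 = q\<^sup>2 * (a\<^sup>2 + b\<^sup>2)"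
proof -
  have ip: "u \<bullet> u = 1" "v \<bullet> v = 1" "w \<bullet> w = 1" "u \<bullet> v = 0" "u \<bullet> w = 0" "v \<bullet> w = 0"
    "v \<bullet> u = 0" "w \<bullet> u = 0" "w \<bullet> v = 0"
    using assms(1) by (auto simp: orthonormal3_def norm_eq_1 inner_commute)
  have "X \<bullet> X = a\<^sup>2 + (b\<^sup>2 * (sin t)\<^sup>2 + b\<^sup>2 * (cos t)\<^sup>2)"
    unfolding X by (simp add: inner_simps ip power2_eq_square algebra_simps)
  moreover have "Y \<bullet> Y = q\<^sup>2 * (sin t)\<^sup>2 + q\<^sup>2 * (cos t)\<^sup>2"
    unfolding Y by (simp add: inner_simps ip power2_eq_square algebra_simps)
  moreover have "X \<bullet> Y = 0"
    unfolding X Y by (simp add: inner_simps ip algebra_simps)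
  ultimately show ?thesis
    by (simp flip: distrib_left)
qed

text \<open>The bound on the slope makes the radicand nonnegative, so squaring undoes the root, and
  the sign \<sigma> disappears.\<close>

lemma canal_Q_square:
  assumes "\<sigma> \<in> {1, -1}" "\<bar>D_on I r s\<bar> \<le> 1"
  shows "(canal_Q I \<sigma> r s)\<^sup>2 = (r s)\<^sup>2 - (canal_R I r s)\<^sup>2"
proof -
  have "(D_on I r s)\<^sup>2 \<le> 1"
    using assms(2) by (simp add: abs_square_le_1)
  moreover have "\<sigma>\<^sup>2 = 1"
    using assms(1) by auto
  ultimately show ?thesis
    by (simp add: canal_Q_def canal_R_def power_mult_distrib algebra_simps)
qed

section \<open>Straight center curves\<close>

text \<open>The frame functions are arbitrary off \<open>I\<close>; their constant values on
  \<open>I\<close> therefore get names of their own.\<close>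

locale straight_canal =
  fixes I :: "real set"
    and \<alpha> T N B :: "real \<Rightarrow> real^3"
    and \<sigma> :: real
    and r :: "real \<Rightarrow> real"
    and T0 N0 B0 :: "real^3"
  assumes data: "canal_data I \<alpha> T N B \<sigma> r"
    and frame: "\<And>u. u \<in> I \<Longrightarrow> T u = T0" "\<And>u. u \<in> I \<Longrightarrow> N u = N0" "\<And>u. u \<in> I \<Longrightarrow> B u = B0"
    and orthonormal: "orthonormal3 T0 N0 B0"
begin

abbreviation "r' \<equiv> D_on I r"
text \<open>The product rule applied to \<open>R = r * r'\<close>.\<close>

abbreviation "R' s \<equiv> (r' s)\<^sup>2 + r s * D_on I r' s"
abbreviation "C \<equiv> canal_param I \<alpha> T N B \<sigma> r"

lemma interval: "nondegenerate_interval I" "connected I"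
  using data by (auto simp: canal_data_def nondegenerate_interval_def is_interval_connected_1)

lemma sign: "\<sigma> \<in> {1, -1}"
  using data by (auto simp: canal_data_def)

lemma radius: "s \<in> I \<Longrightarrow> 0 < r s" "s \<in> I \<Longrightarrow> \<bar>r' s\<bar> \<le> 1"
  using data by (auto simp: canal_data_def)

lemma radius_deriv:
  assumes "s \<in> I"
  shows "(r has_real_derivative r' s) (at s within I)"
    and "(r' has_real_derivative D_on I r' s) (at s within I)"
  using smooth_on_interval_D_on[of I r s] data assms
  by (auto simp: canal_data_def has_real_derivative_iff_has_vector_derivative)

lemma center_deriv:
  assumes "s \<in> I"
  shows "(\<alpha> has_vector_derivative T0) (at s within I)"
proof -
  have "T s = D_on I \<alpha> s"
    using data assms unfolding canal_data_def frenet_frame_def by blast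
  then show ?thesis
    using smooth_on_interval_D_on(1)[of I \<alpha> s] data frame(1) assms
    by (simp add: canal_data_def arclength_curve_def)
qed

lemma canal_R_deriv:
  assumes "s \<in> I"
  shows "(canal_R I r has_real_derivative R' s) (at s within I)"
  unfolding canal_R_def
  by (auto intro!: derivative_eq_intros radius_deriv assms simp: power2_eq_square)

lemma first_form_det:
  assumes "s \<in> I"
    and "(canal_Q I \<sigma> r has_real_derivative Q') (at s within I)"
  shows "coeff_E I C s t * coeff_G C s t - (coeff_F I C s t)\<^sup>2 =
    (canal_Q I \<sigma> r s)\<^sup>2 * ((1 - R' s)\<^sup>2 + Q'\<^sup>2)"
  unfolding coeff_E_def coeff_F_def coeff_G_def
  by (rule orthonormal3_gram_det[OF orthonormal
        canal_partial_s[OF interval(1) assms(1) frame center_deriv canal_R_deriv assms(2)]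
        canal_partial_t[of I \<alpha> T N B \<sigma> r s t, unfolded frame[OF assms(1)]]])
    (use assms(1) in simp_all)

section \<open>Degeneracy forces an exceptional radius function\<close>

lemma canal_Q_differentiable:
  assumes "s \<in> I" "canal_Q I \<sigma> r s \<noteq> 0"
  obtains Q' where "(canal_Q I \<sigma> r has_real_derivative Q') (at s within I)"
proof -
  \<comment> \<open>A nonzero \<open>Q\<close> keeps the radicand away from 0, the point where the
    square root is not differentiable.\<close>
  have "(r' s)\<^sup>2 \<noteq> 1" "(r' s)\<^sup>2 \<le> 1"
    using assms radius(2)[OF assms(1)] by (auto simp: canal_Q_def abs_square_le_1)
  then have "0 < 1 - (r' s)\<^sup>2"
    by simp
  then have "\<exists>Q'. (canal_Q I \<sigma> r has_real_derivative Q') (at s within I)"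
    unfolding canal_Q_def
    by (intro exI) (rule derivative_eq_intros radius_deriv assms refl | simp)+
  then show ?thesis
    using that by blast
qed

lemma degenerate_pointwise:
  assumes "degenerate_surface I C" "s \<in> I"
  shows "canal_Q I \<sigma> r s = 0 \<or> R' s = 1"
proof (cases "canal_Q I \<sigma> r s = 0")
  case False
  then obtain Q' where "(canal_Q I \<sigma> r has_real_derivative Q') (at s within I)"
    using canal_Q_differentiable assms(2) by blast
  then have "(canal_Q I \<sigma> r s)\<^sup>2 * ((1 - R' s)\<^sup>2 + Q'\<^sup>2) = 0"
    \<comment> \<open>The determinant does not depend on \<open>t\<close>, so its value at
      \<open>t = 0\<close> suffices.\<close>
    using first_form_det[of s Q' 0] assms by (auto simp: degenerate_surface_def)
  then have "1 - R' s = 0"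
    using False by (simp add: sum_power2_eq_zero_iff)
  then show ?thesis
    by simp
qed simp

text \<open>The alternative \<open>Q = 0\<close> or \<open>R' = 1\<close> could a priori change from
  point to point; constancy of \<open>Q\<^sup>2\<close> is what makes it uniform on
  \<open>I\<close>.\<close>

lemma degenerate_imp_Q_square_constant:
  assumes "degenerate_surface I C"
  obtains k where "\<And>s. s \<in> I \<Longrightarrow> (r s)\<^sup>2 - (canal_R I r s)\<^sup>2 = k"
proof -
  define q where "q = (\<lambda>s. (r s)\<^sup>2 - (canal_R I r s)\<^sup>2)"
  have qd: "(q has_real_derivative 2 * canal_R I r s * (1 - R' s)) (at s within I)"
    if "s \<in> I" for s
    unfolding q_def
    by (rule derivative_eq_intros radius_deriv canal_R_deriv that refl)+
      (simp add: canal_R_def algebra_simps)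
  have "((\<lambda>s. (q s)\<^sup>2) has_real_derivative 0) (at s within I)" if "s \<in> I" for s
  proof -
    have "q s = 0 \<or> R' s = 1"
      using degenerate_pointwise[OF assms that] canal_Q_square[OF sign radius(2)[OF that]]
      by (auto simp: q_def)
    \<comment> \<open>Up to a factor 2 this is the derivative of \<open>q\<^sup>2\<close>; each
      alternative kills one factor.\<close>
    then have "q s * (2 * canal_R I r s * (1 - R' s)) = 0"
      by auto
    then show ?thesis
      by (auto intro!: derivative_eq_intros qd that)
  qed
  then obtain c where c: "\<And>s. s \<in> I \<Longrightarrow> (q s)\<^sup>2 = c"
    using zero_derivative_constant[OF interval(1)] by blast
  \<comment> \<open>Since \<open>q\<close> is a square, it is nonnegative and can be recovered from
    \<open>q\<^sup>2\<close> without a choice of sign.\<close>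
  have "q s = sqrt c" if "s \<in> I" for s
  proof -
    have "0 \<le> q s"
      unfolding q_def canal_Q_square[OF sign radius(2)[OF that], symmetric] by simp
    then show ?thesis
      using c[OF that] by (metis real_sqrt_unique)
  qed
  then show ?thesis
    using that by (simp add: q_def)
qed

lemma unit_slope_imp_linear:
  assumes "\<And>s. s \<in> I \<Longrightarrow> (r' s)\<^sup>2 = 1"
  shows "\<exists>c. (\<forall>s\<in>I. r s = s + c) \<or> (\<forall>s\<in>I. r s = - s + c)"
proof -
  have "continuous_on I r'"
    using radius_deriv(2) DERIV_continuous_on by blast
  then have cases: "(\<forall>s\<in>I. r' s = 1) \<or> (\<forall>s\<in>I. r' s = -1)"
    using continuous_square_one_cases[OF interval(2) _ assms] by simp
  have linear: "\<exists>c. \<forall>s\<in>I. r s = e * s + c" if e: "\<forall>s\<in>I. r' s = e" for e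
  proof -
    have "((\<lambda>s. r s - e * s) has_real_derivative 0) (at s within I)" if "s \<in> I" for s
      using e that by (auto intro!: derivative_eq_intros radius_deriv)
    then obtain c where c: "\<And>s. s \<in> I \<Longrightarrow> r s - e * s = c"
      using zero_derivative_constant[OF interval(1), of "\<lambda>s. r s - e * s"] by blast
    have "r s = e * s + c" if "s \<in> I" for s
      using c[OF that] by simp
    then show ?thesis
      by blast
  qed
  from cases show ?thesis
  proof
    assume "\<forall>s\<in>I. r' s = 1"
    from linear[OF this] show ?thesis by auto
  next
    assume "\<forall>s\<in>I. r' s = -1"
    from linear[OF this] show ?thesis by auto
  qed
qed

text \<open>Two integrations: \<open>R = s + a\<close>, and then \<open>(r\<^sup>2)' = 2 * R\<close>
  gives \<open>r\<^sup>2 = s\<^sup>2 + 2 * a * s + b\<close>.\<close>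

lemma R_slope_one_imp_sqrt:
  assumes "\<And>s. s \<in> I \<Longrightarrow> R' s = 1"
  shows "\<exists>c1 c2. \<forall>s\<in>I. r s = sqrt (s\<^sup>2 - 2 * c1 * s + 2 * c2)"
proof -
  have "((\<lambda>s. canal_R I r s - s) has_real_derivative 0) (at s within I)" if "s \<in> I" for s
    by (rule derivative_eq_intros canal_R_deriv that refl)+ (use assms[OF that] in simp)
  then obtain a where a: "\<And>s. s \<in> I \<Longrightarrow> canal_R I r s - s = a"
    using zero_derivative_constant[OF interval(1)] by blast
  have "((\<lambda>s. (r s)\<^sup>2 - s\<^sup>2 - 2 * a * s) has_real_derivative 0) (at s within I)"
    if "s \<in> I" for s
    by (rule derivative_eq_intros radius_deriv that refl)+
      (use a[OF that] in \<open>simp add: canal_R_def algebra_simps\<close>)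
  then obtain b where b: "\<And>s. s \<in> I \<Longrightarrow> (r s)\<^sup>2 - s\<^sup>2 - 2 * a * s = b"
    using zero_derivative_constant[OF interval(1)] by blast
  \<comment> \<open>Matching coefficients gives \<open>c1 = - a\<close> and
    \<open>c2 = b / 2\<close>; positivity of \<open>r\<close> selects the positive root.\<close>
  have "r s = sqrt (s\<^sup>2 - 2 * (- a) * s + 2 * (b / 2))" if "s \<in> I" for s
  proof (rule real_sqrt_unique[symmetric])
    show "(r s)\<^sup>2 = s\<^sup>2 - 2 * (- a) * s + 2 * (b / 2)"
      using b[OF that] by (simp add: algebra_simps)
  qed (use radius(1)[OF that] in simp)
  then show ?thesis
    by blast
qed

lemma degenerate_imp_form:
  assumes "degenerate_surface I C"
  shows "(\<exists>c. (\<forall>s\<in>I. r s = s + c) \<or> (\<forall>s\<in>I. r s = - s + c)) \<or>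
    (\<exists>c1 c2. \<forall>s\<in>I. r s = sqrt (s\<^sup>2 - 2 * c1 * s + 2 * c2))"
proof -
  obtain k where k: "\<And>s. s \<in> I \<Longrightarrow> (r s)\<^sup>2 - (canal_R I r s)\<^sup>2 = k"
    using degenerate_imp_Q_square_constant[OF assms] by blast
  show ?thesis
  proof (cases "k = 0")
    case True
    have "(r' s)\<^sup>2 = 1" if "s \<in> I" for s
    proof -
      have "(r s)\<^sup>2 * (1 - (r' s)\<^sup>2) = 0"
        using k[OF that] True by (simp add: canal_R_def power_mult_distrib algebra_simps)
      then show ?thesis
        using radius(1)[OF that] by simp
    qed
    then show ?thesis
      using unit_slope_imp_linear by blast
  next
    case False
    \<comment> \<open>As \<open>k\<close> is the constant value of \<open>Q\<^sup>2\<close>,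
      \<open>Q\<close> vanishes nowhere and the other alternative holds at every point.\<close>
    have "R' s = 1" if "s \<in> I" for s
      using degenerate_pointwise[OF assms that] canal_Q_square[OF sign radius(2)[OF that]]
        k[OF that] False by auto
    then show ?thesis
      using R_slope_one_imp_sqrt by blast
  qed
qed

section \<open>The exceptional radius functions give degenerate surfaces\<close>

lemma linear_imp_degenerate:
  assumes "\<And>s. s \<in> I \<Longrightarrow> r s = e * s + c" and "e\<^sup>2 = 1"
  shows "degenerate_surface I C"
proof -
  have "canal_Q I \<sigma> r s = 0" if "s \<in> I" for s
  proof -
    have "((\<lambda>s. e * s + c) has_vector_derivative e) (at s within I)"
      by (auto intro!: derivative_eq_intros)
    then have "(r has_vector_derivative e) (at s within I)"
      by (rule has_vector_derivative_transform[rotated 2]) (use assms that in auto)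
    then have "r' s = e"
      using D_on_eqI interval(1) that by blast
    then show ?thesis
      using assms(2) by (simp add: canal_Q_def)
  qed
  \<comment> \<open>With \<open>Q = 0\<close> the partial derivative in \<open>t\<close> is zero, so
    \<open>F = G = 0\<close> whatever the value of \<open>E\<close>.\<close>
  then show ?thesis
    by (simp add: degenerate_surface_def coeff_F_def coeff_G_def canal_partial_t)
qed

text \<open>Here \<open>R = s - c1\<close> and \<open>Q\<close> is constant, so
  \<open>R' = 1\<close>, \<open>Q' = 0\<close> and the parametrization does not move with
  \<open>s\<close>: the surface collapses to a circle, or to a point if
  \<open>2 * c2 = c1\<^sup>2\<close>.\<close>

lemma sqrt_imp_degenerate:
  assumes r: "\<And>s. s \<in> I \<Longrightarrow> r s = sqrt (s\<^sup>2 - 2 * c1 * s + 2 * c2)"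
  shows "degenerate_surface I C"
proof -
  \<comment> \<open>Positivity of the radius passes to the radicand, which makes the root
    differentiable on \<open>I\<close>.\<close>
  have pos: "0 < s\<^sup>2 - 2 * c1 * s + 2 * c2" if "s \<in> I" for s
    using radius(1)[OF that] r[OF that] by simp
  have R: "canal_R I r s = s - c1" if "s \<in> I" for s
  proof -
    have "((\<lambda>s. s\<^sup>2 - 2 * c1 * s + 2 * c2) has_real_derivative 2 * (s - c1)) (at s within I)"
      by (auto intro!: derivative_eq_intros)
    then have "((\<lambda>s. sqrt (s\<^sup>2 - 2 * c1 * s + 2 * c2)) has_real_derivative
        inverse (r s) / 2 * (2 * (s - c1))) (at s within I)"
      unfolding r[OF that] by (intro DERIV_chain2[where f = sqrt] DERIV_real_sqrt pos that)
    also have "inverse (r s) / 2 * (2 * (s - c1)) = (s - c1) / r s"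
      by (simp add: divide_simps)
    finally have "((\<lambda>s. sqrt (s\<^sup>2 - 2 * c1 * s + 2 * c2)) has_real_derivative
        (s - c1) / r s) (at s within I)" .
    then have "((\<lambda>s. sqrt (s\<^sup>2 - 2 * c1 * s + 2 * c2)) has_vector_derivative (s - c1) / r s)
        (at s within I)"
      by (simp add: has_real_derivative_iff_has_vector_derivative)
    then have "(r has_vector_derivative (s - c1) / r s) (at s within I)"
      by (rule has_vector_derivative_transform[rotated 2]) (use r that in auto)
    then have "r' s = (s - c1) / r s"
      using D_on_eqI interval(1) that by blast
    then show ?thesis
      using radius(1)[OF that] by (simp add: canal_R_def)
  qed
  have Q: "canal_Q I \<sigma> r s = \<sigma> * sqrt (2 * c2 - c1\<^sup>2)" if "s \<in> I" for s
  proof -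
    have "r s * sqrt (1 - (r' s)\<^sup>2) = sqrt ((r s)\<^sup>2 * (1 - (r' s)\<^sup>2))"
      using radius(1)[OF that] by (simp add: real_sqrt_mult)
    also have "(r s)\<^sup>2 * (1 - (r' s)\<^sup>2) = (r s)\<^sup>2 - (canal_R I r s)\<^sup>2"
      by (simp add: canal_R_def power_mult_distrib algebra_simps)
    also have "\<dots> = 2 * c2 - c1\<^sup>2"
      using pos[OF that] by (simp add: R[OF that] r[OF that] power2_diff)
    finally show ?thesis
      by (simp add: canal_Q_def)
  qed
  have "coeff_E I C s t * coeff_G C s t - (coeff_F I C s t)\<^sup>2 = 0" if "s \<in> I" for s t
  proof -
    have "((\<lambda>s. \<sigma> * sqrt (2 * c2 - c1\<^sup>2)) has_real_derivative 0) (at s within I)"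
      by simp
    then have Qd: "(canal_Q I \<sigma> r has_real_derivative 0) (at s within I)"
      unfolding has_real_derivative_iff_has_vector_derivative
      by (rule has_vector_derivative_transform[rotated 2]) (use Q that in auto)
    have "((\<lambda>s. s - c1) has_real_derivative 1) (at s within I)"
      by (auto intro!: derivative_eq_intros)
    then have "(canal_R I r has_real_derivative 1) (at s within I)"
      unfolding has_real_derivative_iff_has_vector_derivative
      by (rule has_vector_derivative_transform[rotated 2]) (use R that in auto)
    \<comment> \<open>\<open>R'\<close> stands for an expression in \<open>r''\<close>; uniqueness
      of the derivative within \<open>I\<close> identifies it with 1.\<close>
    then have "R' s = 1"
      using canal_R_deriv[OF that] D_on_eqI[OF interval(1) that]
      by (metis has_real_derivative_iff_has_vector_derivative)
    then show ?thesis
      by (simp add: first_form_det[OF that Qd])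
  qed
  then show ?thesis
    by (simp add: degenerate_surface_def)
qed

lemma degenerate_iff:
  "degenerate_surface I C \<longleftrightarrow>
    (\<exists>c. (\<forall>s\<in>I. r s = s + c) \<or> (\<forall>s\<in>I. r s = - s + c)) \<or>
    (\<exists>c1 c2. \<forall>s\<in>I. r s = sqrt (s\<^sup>2 - 2 * c1 * s + 2 * c2))"
  using degenerate_imp_form linear_imp_degenerate[of 1] linear_imp_degenerate[of "-1"]
    sqrt_imp_degenerate by auto

end

theorem theorem3:
  fixes I :: "real set"
    and \<alpha> T N B :: "real \<Rightarrow> real^3"
    and \<sigma> :: real
    and r :: "real \<Rightarrow> real"
  assumes "canal_data I \<alpha> T N B \<sigma> r"
    and "straight_line I \<alpha>"
  shows "regular_surface I (canal_param I \<alpha> T N B \<sigma> r) \<longleftrightarrow>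
    \<not> (\<exists>c. (\<forall>s\<in>I. r s = s + c) \<or> (\<forall>s\<in>I. r s = - s + c)) \<and>
    \<not> (\<exists>c1 c2. \<forall>s\<in>I. r s = sqrt (s\<^sup>2 - 2 * c1 * s + 2 * c2))"
proof -
  have const: "T constant_on I" "N constant_on I" "B constant_on I"
    and orth: "\<forall>s\<in>I. orthonormal3 (T s) (N s) (B s)"
    using assms by (auto simp: canal_data_def frenet_frame_def)
  obtain T0 N0 B0 where frame: "\<forall>s\<in>I. T s = T0" "\<forall>s\<in>I. N s = N0" "\<forall>s\<in>I. B s = B0"
    using const unfolding constant_on_def by blast
  \<comment> \<open>A point of \<open>I\<close> is required to carry orthonormality over to the
    constant vectors.\<close>
  obtain s where "s \<in> I"
    using assms(1) interior_subset by (auto simp: canal_data_def nondegenerate_interval_def)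
  then have "orthonormal3 T0 N0 B0"
    using orth frame by metis
  then interpret straight_canal I \<alpha> T N B \<sigma> r T0 N0 B0
    using assms(1) frame by unfold_locales auto
  show ?thesis
    unfolding regular_surface_def degenerate_iff by blast
qed

end
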